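(* Let $\gamma_1,\gamma_2,\varkappa,\varrho,\Upsilon\in\mathbb{C}$ have positive real parts. For $\left|\frac{w^\Upsilon}{q^\Upsilon}\right|<1$, the Laplace transform (in $Y$, with transform variable $q$, $\mathrm{Re}(q)>0$) of the modified bivariate H–K Mittag-Leffler function with $\gamma_3=\frac{\gamma_1+1}{2}$ and $\gamma_4=\gamma_2$ satisfies $$\mathbb{L}\left[Y^{\varrho-1}E_{\varkappa,\varrho,\Upsilon}^{(\gamma_1;\gamma_2;\frac{\gamma_1+1}{2};\gamma_2)}(X,wY)\right](q)=\frac{1}{q^\varrho}\left[\frac{q^\Upsilon-w^\Upsilon}{q^\Upsilon}\right]^{-\gamma_2}E_{1,\varkappa+1}^{\frac{\gamma_1}{2}}\left(\frac{4q^{\Upsilon}X}{q^{\Upsilon}-w^{\Upsilon}}\right).$$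
   Context: $(a)_k$ is the Pochhammer symbol. The modified bivariate H–K Mittag-Leffler function is $$E_{\varkappa,\varrho,\Upsilon}^{(\gamma_1;\gamma_2;\gamma_3;\gamma_4)}(X,Y)=\sum_{s=0}^\infty\sum_{r=0}^\infty\frac{(\gamma_1)_{2s}(\gamma_2)_{s+r}X^sY^{\Upsilon r}}{(\gamma_3)_s(\gamma_4)_s\Gamma(\varkappa+s)\Gamma(\varrho+\Upsilon r)\,r!\,s!},$$ for complex parameters with positive real parts. The Prabhakar Mittag-Leffler function is $E_{a,b}^{\gamma}(z)=\sum_{n=0}^\infty\frac{(\gamma)_nz^n}{\Gamma(an+b)\,n!}$. The Laplace transform is $\mathbb{L}[f](q)=\int_0^\infty e^{-qY}f(Y)\,dY$, $\mathrm{Re}(q)>0$.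
   Formalization: The index ϰ+1 of the Prabhakar function is corrected to ϰ (the printed identity fails at X=0, ϰ≠1), and the identity is asserted where the Laplace integral converges absolutely; convergence is proved for large Re(q), and for Re(q)>|w| when Υ is real. *)

theory Defs
  imports "HOL-Analysis.Analysis"
begin

(* The monomial Y^(u r) is rendered as (Y powr u) ^ r, with the principal power.  For Y \<noteq> 0 this
   is Y powr (u * r); at Y = 0 it keeps the r = 0 term equal to 1, whereas the totalised
   "0 powr 0" is 0. *)
definition HK_mittag_leffler ::
    "complex \<Rightarrow> complex \<Rightarrow> complex \<Rightarrow> complex \<Rightarrow> complex \<Rightarrow> complex \<Rightarrow> complex \<Rightarrow> complex \<Rightarrow> complex \<Rightarrow> complex"
  where
  "HK_mittag_leffler \<kappa> \<rho> \<upsilon> \<gamma>1 \<gamma>2 \<gamma>3 \<gamma>4 X Y =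
     (\<Sum>s. \<Sum>r. pochhammer \<gamma>1 (2 * s) * pochhammer \<gamma>2 (s + r) * X ^ s * (Y powr \<upsilon>) ^ r /
        (pochhammer \<gamma>3 s * pochhammer \<gamma>4 s * Gamma (\<kappa> + of_nat s) * Gamma (\<rho> + \<upsilon> * of_nat r) *
         fact r * fact s))"

definition prabhakar :: "complex \<Rightarrow> complex \<Rightarrow> complex \<Rightarrow> complex \<Rightarrow> complex" where
  "prabhakar a b \<gamma> z =
     (\<Sum>n. pochhammer \<gamma> n * z ^ n / (Gamma (a * of_nat n + b) * fact n))"

(* The Bochner integral is 0 for non-integrable integrands, so that the value of "laplace f q" is
   meaningful only together with "laplace_exists f q". *)
definition laplace_exists :: "(real \<Rightarrow> complex) \<Rightarrow> complex \<Rightarrow> bool" where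
  "laplace_exists f q \<longleftrightarrow>
     set_integrable lborel {0<..} (\<lambda>Y. exp (- q * complex_of_real Y) * f Y)"

definition laplace :: "(real \<Rightarrow> complex) \<Rightarrow> complex \<Rightarrow> complex" where
  "laplace f q = (LINT Y:{0<..}|lborel. exp (- q * complex_of_real Y) * f Y)"

end

theory Submission
  imports Defs "HOL-Complex_Analysis.Complex_Analysis"
begin

text \<open>
  Write \<open>z = w^\<upsilon> / q^\<upsilon>\<close>. By the duplication formula for the Pochhammer symbol the \<open>\<gamma>3\<close>- and \<open>\<gamma>4\<close>-factors
  cancel, the \<open>r\<close>-series transforms termwise into the binomial series of \<open>(1 - z)^(- \<gamma>2 - s)\<close>, and the
  remaining \<open>s\<close>-series is the Prabhakar function at \<open>4 X / (1 - z)\<close>.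

  Fubini needs a bound for \<open>Gamma (Re x) / \<bar>Gamma x\<bar>\<close> at \<open>x = \<rho> + \<upsilon> r\<close>. Its square is
  \<open>\<Prod>k. 1 + (Im x)^2 / (Re x + k)^2\<close>, which grows at most geometrically in \<open>r\<close> and stays bounded for
  real \<open>\<upsilon>\<close>. This gives absolute convergence far to the right, and for real \<open>\<upsilon>\<close> already for
  \<open>Re q > \<bar>w\<bar>\<close>.

  At an arbitrary admissible \<open>q\<close> both sides are holomorphic on
  \<open>{p. Re p > Re q \<and> \<bar>w^\<upsilon> / p^\<upsilon>\<bar> < 1}\<close>, which is connected and contains a half-plane, so they agree
  there. Since \<open>q\<close> is only a boundary point of this set, it is reached by dominated convergence along
  its own ray.
\<close>

subsection \<open>Lower bounds for the Gamma function off the real axis\<close>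

lemma not_nonpos_Ints_if_Re_pos:
  fixes z :: complex
  assumes "Re z > 0"
  shows "z \<notin> \<int>\<^sub>\<le>\<^sub>0"
  using assms by (auto elim!: nonpos_Ints_cases')

text \<open>Telescoping with \<open>1 / (t + 1)\<^sup>2 \<le> 1 / t - 1 / (t + 1)\<close>. The
  subtracted last term carries the induction; afterwards only the bound uniform in \<open>n\<close>
  is used.\<close>

lemma sum_inverse_squares_shifted_le:
  fixes x :: real
  assumes "x > 0"
  shows "(\<Sum>k\<le>n. 1 / (x + real k)\<^sup>2) \<le> 1 / x\<^sup>2 + 1 / x - 1 / (x + real n)"
proof (induction n)
  case (Suc n)
  have "1 / (x + real n + 1)\<^sup>2 \<le> 1 / (x + real n) - 1 / (x + real n + 1)"
    using assms by (simp add: divide_simps power2_eq_square)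
  with Suc show ?case
    by (simp add: add_ac)
qed simp

text \<open>Each factor exceeds its real part \<open>x + k\<close> by the square root of
  \<open>1 + y\<^sup>2 / (x + k)\<^sup>2\<close>, and \<open>1 + t \<le> exp t\<close> turns the
  product of these corrections into the exponential of a bounded sum. The constant does not depend
  on \<open>n\<close>, so it survives the limit defining Gamma.\<close>

lemma norm_pochhammer_le_Re:
  fixes z :: complex
  assumes "Re z > 0"
  shows "norm (pochhammer z (Suc n))
           \<le> pochhammer (Re z) (Suc n) * exp ((Im z)\<^sup>2 / 2 * (1 / (Re z)\<^sup>2 + 1 / Re z))"
proof -
  define x y where "x = Re z" and "y = Im z"
  have x: "x > 0"
    using assms by (simp add: x_def)
  have le: "norm (z + of_nat k) \<le> (x + real k) * exp (y\<^sup>2 / 2 * (1 / (x + real k)\<^sup>2))" for k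
  proof -
    define t where "t = x + real k"
    have t: "t > 0"
      using x by (simp add: t_def)
    have "(norm (z + of_nat k))\<^sup>2 = t\<^sup>2 + y\<^sup>2"
      by (simp add: cmod_power2 t_def x_def y_def)
    also have "\<dots> = t\<^sup>2 * (1 + y\<^sup>2 / t\<^sup>2)"
      using t by (simp add: field_simps)
    also have "\<dots> \<le> t\<^sup>2 * exp (y\<^sup>2 / t\<^sup>2)"
      by (intro mult_left_mono exp_ge_add_one_self) auto
    also have "\<dots> = (t * exp (y\<^sup>2 / 2 * (1 / t\<^sup>2)))\<^sup>2"
      by (simp add: power_mult_distrib flip: exp_double)
    finally show ?thesis
      using t by (auto intro: power2_le_imp_le simp: t_def)
  qed
  have "norm (pochhammer z (Suc n)) = (\<Prod>k\<le>n. norm (z + of_nat k))"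
    by (simp add: pochhammer_Suc_prod prod_norm atLeast0AtMost)
  also have "\<dots> \<le> (\<Prod>k\<le>n. (x + real k) * exp (y\<^sup>2 / 2 * (1 / (x + real k)\<^sup>2)))"
    by (intro prod_mono) (use le in auto)
  also have "\<dots> = pochhammer x (Suc n) * exp (y\<^sup>2 / 2 * (\<Sum>k\<le>n. 1 / (x + real k)\<^sup>2))"
    by (simp add: prod.distrib pochhammer_Suc_prod exp_sum sum_distrib_left atLeast0AtMost)
  also have "\<dots> \<le> pochhammer x (Suc n) * exp (y\<^sup>2 / 2 * (1 / x\<^sup>2 + 1 / x))"
  proof -
    have "(\<Sum>k\<le>n. 1 / (x + real k)\<^sup>2) \<le> 1 / x\<^sup>2 + 1 / x"
      using sum_inverse_squares_shifted_le[OF x, of n] x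
      by (smt (verit) divide_nonneg_nonneg of_nat_0_le_iff)
    then show ?thesis
      using x by (intro mult_left_mono exp_le_cancel_iff[THEN iffD2])
        (auto intro!: mult_left_mono pochhammer_nonneg simp del: exp_le_cancel_iff)
  qed
  finally show ?thesis
    by (simp add: x_def y_def)
qed

text \<open>Limit of the Pochhammer bound in Euler's formula \<open>Gamma_series\<close>: the
  numerators at \<open>z\<close> and \<open>Re z\<close> have the same modulus, so only the
  denominators need comparison.\<close>

lemma Gamma_Re_le:
  fixes z :: complex
  assumes "Re z > 0"
  shows "Gamma (Re z) \<le> norm (Gamma z) * exp ((Im z)\<^sup>2 / 2 * (1 / (Re z)\<^sup>2 + 1 / Re z))"
    (is "_ \<le> _ * ?E")
proof (rule LIMSEQ_le)
  show "Gamma_series (Re z) \<longlonglongrightarrow> Gamma (Re z)"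
    by (rule Gamma_series_LIMSEQ)
  show "(\<lambda>n. norm (Gamma_series z n) * ?E) \<longlonglongrightarrow> norm (Gamma z) * ?E"
    by (intro tendsto_intros)
  have "Gamma_series (Re z) n \<le> norm (Gamma_series z n) * ?E" for n
  proof -
    have pos: "pochhammer (Re z) (Suc n) > 0"
      using assms by (rule pochhammer_pos)
    have nz: "pochhammer z (Suc n) \<noteq> 0"
      using assms by (auto dest!: pochhammer_eq_0_imp_nonpos_Int simp: not_nonpos_Ints_if_Re_pos)
    have "1 / pochhammer (Re z) (Suc n) \<le> ?E / norm (pochhammer z (Suc n))"
      using norm_pochhammer_le_Re[OF assms, of n] pos nz by (simp add: field_simps)
    then have "fact n * exp (Re z * ln (real n)) * (1 / pochhammer (Re z) (Suc n))
        \<le> fact n * exp (Re z * ln (real n)) * (?E / norm (pochhammer z (Suc n)))"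
      by (intro mult_left_mono) auto
    then show ?thesis
      by (simp add: Gamma_series_def norm_mult norm_divide)
  qed
  then show "\<exists>N. \<forall>n\<ge>N. Gamma_series (Re z) n \<le> norm (Gamma_series z n) * ?E"
    by blast
qed

text \<open>Along \<open>\<rho> + \<upsilon> r\<close> the squared imaginary part grows like
  \<open>r^2\<close> while \<open>1 / x\<^sup>2 + 1 / x\<close> decays like \<open>1 / r\<close>.
  The exponent of \<open>Gamma_Re_le\<close> is therefore at most linear in \<open>r\<close>, with
  slope proportional to \<open>(Im \<upsilon>)\<^sup>2\<close>; this vanishes for real
  \<open>\<upsilon>\<close>.\<close>

lemma Gamma_Re_le_affine:
  fixes \<rho> \<upsilon> :: complex
  assumes "Re \<rho> > 0" and "Re \<upsilon> > 0"
  obtains M K where "M > 0" and "K > 0" and "\<upsilon> \<in> \<real> \<Longrightarrow> K = 1"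
    and "\<And>r. Gamma (Re (\<rho> + \<upsilon> * of_nat r)) \<le> M * K ^ r * norm (Gamma (\<rho> + \<upsilon> * of_nat r))"
proof -
  define x0 a where "x0 = Re \<rho>" and "a = Re \<upsilon>"
  define C where "C = 1 / x0\<^sup>2 + 1 / x0"
  define k where "k = (Im \<upsilon>)\<^sup>2 * (1 / x0 + 1) / a"
  have pos: "x0 > 0" "a > 0" "C > 0"
    using assms by (auto simp: x0_def a_def C_def intro!: add_pos_pos)
  have le: "(Im (\<rho> + \<upsilon> * of_nat r))\<^sup>2 / 2 * (1 / (Re (\<rho> + \<upsilon> * of_nat r))\<^sup>2 + 1 / Re (\<rho> + \<upsilon> * of_nat r))
      \<le> (Im \<rho>)\<^sup>2 * C + k * real r" for r
  proof -
    define x where "x = x0 + a * real r"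
    have x: "x \<ge> x0" "x > 0" "a * real r \<le> x"
      using pos by (auto simp: x_def intro: add_pos_nonneg)
    have B: "1 / x\<^sup>2 + 1 / x \<le> C"
      unfolding C_def using x pos by (intro add_mono divide_left_mono power_mono) auto
    \<comment> \<open>The inequality \<open>(u + v)^2 \<le> 2 (u^2 + v^2)\<close> separates the
      constant part from the part growing with \<open>r\<close>.\<close>
    have "(Im \<rho> + Im \<upsilon> * real r)\<^sup>2 \<le> 2 * ((Im \<rho>)\<^sup>2 + (Im \<upsilon> * real r)\<^sup>2)"
      using sum_squares_bound[of "Im \<rho>" "Im \<upsilon> * real r"] by (simp add: power2_sum)
    then have "(Im \<rho> + Im \<upsilon> * real r)\<^sup>2 / 2 * (1 / x\<^sup>2 + 1 / x)
        \<le> ((Im \<rho>)\<^sup>2 + (Im \<upsilon> * real r)\<^sup>2) * (1 / x\<^sup>2 + 1 / x)"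
      using x by (intro mult_right_mono) auto
    also have "\<dots> = (Im \<rho>)\<^sup>2 * (1 / x\<^sup>2 + 1 / x) + (Im \<upsilon> * real r)\<^sup>2 * (1 / x\<^sup>2 + 1 / x)"
      by (rule distrib_right)
    also have "\<dots> \<le> (Im \<rho>)\<^sup>2 * C + k * real r"
    proof (rule add_mono)
      show "(Im \<rho>)\<^sup>2 * (1 / x\<^sup>2 + 1 / x) \<le> (Im \<rho>)\<^sup>2 * C"
        using B by (intro mult_left_mono) auto
      \<comment> \<open>One factor \<open>1 / x\<close> is kept: through
        \<open>r / x \<le> 1 / a\<close> it absorbs one of the two powers of
        \<open>r\<close>.\<close>
      have "1 / x\<^sup>2 + 1 / x = (1 / x + 1) * (1 / x)"
        using x by (simp add: field_simps power2_eq_square)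
      also have "\<dots> \<le> (1 / x0 + 1) * (1 / x)"
        using x pos by (intro mult_right_mono add_right_mono divide_left_mono) auto
      finally have "(Im \<upsilon> * real r)\<^sup>2 * (1 / x\<^sup>2 + 1 / x)
          \<le> (Im \<upsilon> * real r)\<^sup>2 * ((1 / x0 + 1) * (1 / x))"
        by (intro mult_left_mono) auto
      also have "\<dots> = (Im \<upsilon>)\<^sup>2 * (1 / x0 + 1) * real r * (real r / x)"
        by (simp add: power2_eq_square)
      also have "\<dots> \<le> (Im \<upsilon>)\<^sup>2 * (1 / x0 + 1) * real r * (1 / a)"
        using x pos by (intro mult_left_mono) (auto simp: field_simps)
      finally show "(Im \<upsilon> * real r)\<^sup>2 * (1 / x\<^sup>2 + 1 / x) \<le> k * real r"
        by (simp add: k_def)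
    qed
    finally show ?thesis
      by (simp add: x_def x0_def a_def)
  qed
  show ?thesis
  proof (rule that[of "exp ((Im \<rho>)\<^sup>2 * C)" "exp k"])
    show "exp k = 1" if "\<upsilon> \<in> \<real>"
      using that by (simp add: k_def complex_is_Real_iff)
    fix r
    have "Re (\<rho> + \<upsilon> * of_nat r) > 0"
      using pos by (auto simp: x0_def a_def intro: add_pos_nonneg)
    then have "Gamma (Re (\<rho> + \<upsilon> * of_nat r)) \<le> norm (Gamma (\<rho> + \<upsilon> * of_nat r)) *
       exp ((Im (\<rho> + \<upsilon> * of_nat r))\<^sup>2 / 2 * (1 / (Re (\<rho> + \<upsilon> * of_nat r))\<^sup>2 + 1 / Re (\<rho> + \<upsilon> * of_nat r)))"
      by (rule Gamma_Re_le)
    also have "\<dots> \<le> norm (Gamma (\<rho> + \<upsilon> * of_nat r)) * exp ((Im \<rho>)\<^sup>2 * C + k * real r)"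
      using le[of r] by (intro mult_left_mono exp_le_cancel_iff[THEN iffD2]) auto
    also have "\<dots> = exp ((Im \<rho>)\<^sup>2 * C) * exp k ^ r * norm (Gamma (\<rho> + \<upsilon> * of_nat r))"
      by (simp add: exp_add exp_of_nat_mult mult.commute[of k])
    finally show "Gamma (Re (\<rho> + \<upsilon> * of_nat r))
        \<le> exp ((Im \<rho>)\<^sup>2 * C) * exp k ^ r * norm (Gamma (\<rho> + \<upsilon> * of_nat r))" .
  qed auto
qed

subsection \<open>Binomial and Prabhakar series\<close>

lemma pochhammer_binomial_sums_complex:
  fixes z a :: complex
  assumes "norm z < 1"
  shows "(\<lambda>n. pochhammer a n / fact n * z ^ n) sums (1 - z) powr (-a)"
proof -
  have "(- a gchoose n) * (- z) ^ n = pochhammer a n / fact n * z ^ n" for n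
    by (simp add: gbinomial_pochhammer flip: power_mult_distrib)
  then show ?thesis
    using gen_binomial_complex[of "-z" "-a"] assms by simp
qed

text \<open>The complex version evaluates the transform; this real one sums the majorants behind the
  Fubini argument.\<close>

lemma pochhammer_binomial_sums_real:
  fixes z a :: real
  assumes "\<bar>z\<bar> < 1"
  shows "(\<lambda>n. pochhammer a n / fact n * z ^ n) sums (1 - z) powr (-a)"
proof -
  have "(- a gchoose n) * (- z) ^ n = pochhammer a n / fact n * z ^ n" for n
    by (simp add: gbinomial_pochhammer flip: power_mult_distrib)
  then show ?thesis
    using gen_binomial_real[of "-z" "-a"] assms by simp
qed

lemma norm_pochhammer_le:
  fixes z :: complex
  shows "norm (pochhammer z n) \<le> pochhammer (norm z) n"
  unfolding pochhammer_prod prod_norm[symmetric]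
  by (intro prod_mono) (auto intro: norm_triangle_le)

text \<open>Ratio test: consecutive terms have quotient
  \<open>(\<gamma> + n) z / ((\<kappa> + n) (n + 1))\<close>, which tends to 0 for every
  \<open>z\<close>.\<close>

lemma summable_prabhakar:
  fixes \<kappa> \<gamma> z :: complex
  assumes "Re \<kappa> > 0"
  shows "summable (\<lambda>n. norm (pochhammer \<gamma> n * z ^ n / (Gamma (\<kappa> + of_nat n) * fact n)))"
proof -
  define f where "f n = pochhammer \<gamma> n * z ^ n / (Gamma (\<kappa> + of_nat n) * fact n)" for n
  \<comment> \<open>From this index on, \<open>(norm \<gamma> + 1) * norm z \<le> n / 2\<close>,
    which forces the quotient below 1/2.\<close>
  define N where "N = nat \<lceil>2 * (norm \<gamma> + 1) * norm z\<rceil>"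
  have "norm (f (Suc n)) \<le> 1 / 2 * norm (f n)" if n: "n \<ge> N" for n
  proof -
    have "2 * (norm \<gamma> + 1) * norm z \<le> real N"
      unfolding N_def by linarith
    with n have zn: "2 * (norm \<gamma> + 1) * norm z \<le> real n"
      by linarith
    have nz: "\<kappa> + of_nat n \<noteq> 0"
      using assms by (auto simp: complex_eq_iff)
    have kn: "real n \<le> norm (\<kappa> + of_nat n)"
      using complex_Re_le_cmod[of "\<kappa> + of_nat n"] assms by simp
    have G: "Gamma (\<kappa> + of_nat (Suc n)) = (\<kappa> + of_nat n) * Gamma (\<kappa> + of_nat n)"
      using Gamma_plus1[of "\<kappa> + of_nat n"] assms
      by (auto simp: add_ac not_nonpos_Ints_if_Re_pos)
    have "f (Suc n) = f n * ((\<gamma> + of_nat n) * z / ((\<kappa> + of_nat n) * of_nat (Suc n)))"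
      by (simp only: f_def G pochhammer_Suc power_Suc fact_Suc) (simp add: mult_ac)
    then have "norm (f (Suc n))
        = norm (f n) * (norm (\<gamma> + of_nat n) * norm z / (norm (\<kappa> + of_nat n) * real (Suc n)))"
      by (simp add: norm_mult norm_divide del: of_nat_Suc)
    also have "\<dots> \<le> norm (f n) * (1 / 2)"
    proof (intro mult_left_mono)
      have "norm (\<gamma> + of_nat n) \<le> norm \<gamma> + real n"
        by (rule norm_triangle_le) simp
      also have "\<dots> \<le> (norm \<gamma> + 1) * real (Suc n)"
        by (simp add: algebra_simps)
      finally have "norm (\<gamma> + of_nat n) * norm z \<le> (norm \<gamma> + 1) * real (Suc n) * norm z"
        by (rule mult_right_mono) simp
      also have "\<dots> = (norm \<gamma> + 1) * norm z * real (Suc n)"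
        by simp
      also have "\<dots> \<le> real n / 2 * real (Suc n)"
        using zn by (intro mult_right_mono) (auto simp: algebra_simps)
      also have "\<dots> \<le> norm (\<kappa> + of_nat n) / 2 * real (Suc n)"
        using kn by (intro mult_right_mono divide_right_mono) auto
      finally show "norm (\<gamma> + of_nat n) * norm z / (norm (\<kappa> + of_nat n) * real (Suc n)) \<le> 1 / 2"
        using nz by (simp add: field_simps del: of_nat_Suc)
    qed simp
    finally show ?thesis
      by simp
  qed
  then have "summable (\<lambda>n. norm (f n))"
    by (intro summable_ratio_test[of "1/2" N]) auto
  then show ?thesis
    by (simp add: f_def)
qed

lemma prabhakar_sums:
  fixes \<kappa> \<gamma> z :: complex
  assumes "Re \<kappa> > 0"
  shows "(\<lambda>n. pochhammer \<gamma> n * z ^ n / (Gamma (\<kappa> + of_nat n) * fact n)) sums prabhakar 1 \<kappa> \<gamma> z"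
  using summable_sums[OF summable_norm_cancel[OF summable_prabhakar[OF assms]]]
  by (simp add: prabhakar_def add.commute)

lemma holomorphic_prabhakar:
  assumes "Re \<kappa> > 0"
  shows "prabhakar 1 \<kappa> \<gamma> holomorphic_on A"
proof -
  have "prabhakar 1 \<kappa> \<gamma> holomorphic_on ball 0 R" for R
    using prabhakar_sums[OF assms, of \<gamma>]
    by (intro power_series_holomorphic
          [where a = "\<lambda>n. pochhammer \<gamma> n / (Gamma (\<kappa> + of_nat n) * fact n)"]) simp
  then have "prabhakar 1 \<kappa> \<gamma> field_differentiable at z" for z
    using holomorphic_on_imp_differentiable_at[of "prabhakar 1 \<kappa> \<gamma>" "ball 0 (norm z + 1)" z] by simp
  then show ?thesis
    by (simp add: holomorphic_on_def field_differentiable_at_within)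
qed

subsection \<open>The Laplace transform\<close>

text \<open>Restricting the measure instead of the integrand lets the theorems on integrals of
  series and on dominated convergence apply without indicator functions.\<close>

abbreviation lborel_pos :: "real measure"
  where "lborel_pos \<equiv> restrict_space lborel {0<..}"

lemma laplace_exists_iff:
  "laplace_exists f q \<longleftrightarrow> integrable lborel_pos (\<lambda>Y. exp (- q * complex_of_real Y) * f Y)"
  by (simp add: laplace_exists_def set_integrable_def integrable_restrict_space)

lemma laplace_eq:
  "laplace f q = (\<integral>Y. exp (- q * complex_of_real Y) * f Y \<partial>lborel_pos)"
  by (simp add: laplace_def set_lebesgue_integral_def integral_restrict_space)

lemma borel_measurable_lborel_pos:
  "f \<in> borel_measurable borel \<Longrightarrow> f \<in> borel_measurable lborel_pos"
  by (rule measurable_restrict_space1) simp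

lemma AE_lborel_pos: "(\<And>Y. Y > 0 \<Longrightarrow> P Y) \<Longrightarrow> AE Y in lborel_pos. P Y"
  by (rule AE_I2) (simp add: space_restrict_space)

text \<open>Measurability at every \<open>p\<close> is inherited from integrability at one
  \<open>q\<close>, multiplying by \<open>exp ((q - p) Y)\<close>; no separate assumption on
  \<open>f\<close> is required.\<close>

lemma borel_measurable_exp_times_lborel_pos:
  fixes f :: "real \<Rightarrow> complex"
  assumes "laplace_exists f q"
  shows "(\<lambda>Y. exp (- p * complex_of_real Y) * f Y) \<in> borel_measurable lborel_pos"
proof -
  have "(\<lambda>Y. exp ((q - p) * complex_of_real Y)) \<in> borel_measurable lborel_pos"
    by (rule borel_measurable_lborel_pos) simp
  from borel_measurable_times[OF this borel_measurable_integrable[OF assms[unfolded laplace_exists_iff]]]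
show ?thesis
    by (simp add: algebra_simps flip: exp_add)
qed

lemma laplace_exists_mono:
  assumes "laplace_exists f q" and "Re q \<le> Re p"
  shows "laplace_exists f p"
  unfolding laplace_exists_iff
proof (rule Bochner_Integration.integrable_bound)
  show "integrable lborel_pos (\<lambda>Y. exp (- q * complex_of_real Y) * f Y)"
    using assms(1) by (simp add: laplace_exists_iff)
  show "(\<lambda>Y. exp (- p * complex_of_real Y) * f Y) \<in> borel_measurable lborel_pos"
    by (rule borel_measurable_exp_times_lborel_pos[OF assms(1)])
  show "AE Y in lborel_pos. norm (exp (- p * complex_of_real Y) * f Y)
      \<le> norm (exp (- q * complex_of_real Y) * f Y)"
    using assms(2) by (intro AE_lborel_pos) (auto simp: norm_mult intro!: mult_right_mono)
qed

text \<open>Expanding the kernel as \<open>exp (- w Y) = exp (- q Y) (\<Sum>n. (- Y)^n (w - q)^n / n!)\<close> turns the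
  transform into a power series around \<open>q\<close>.\<close>

lemma holomorphic_laplace:
  assumes "laplace_exists f q0"
  shows "laplace f holomorphic_on {q. Re q > Re q0}"
proof -
  have "laplace f field_differentiable at q" if q: "Re q > Re q0" for q
  proof -
    define R where "R = Re q - Re q0"
    define F where "F Y = exp (- q * complex_of_real Y) * f Y" for Y
    define a where "a n = (\<integral>Y. complex_of_real ((- Y) ^ n / fact n) * F Y \<partial>lborel_pos)" for n
    have "(\<lambda>n. a n * (w - q) ^ n) sums laplace f w" if w: "w \<in> ball q R" for w
    proof -
      define h where "h = w - q"
      define g where "g n Y = complex_of_real ((- Y) ^ n / fact n) * F Y * h ^ n" for n Y
      \<comment> \<open>\<open>G\<close> is the pointwise sum of the norms of all
        \<open>g n\<close>, hence a common majorant of the terms and of their partial sums.\<close>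
      define G where "G Y = exp (norm h * Y) * norm (F Y)" for Y
      have h: "norm h < R"
        using w by (simp add: h_def dist_norm norm_minus_commute)
      have F: "F \<in> borel_measurable lborel_pos"
        unfolding F_def[abs_def] by (rule borel_measurable_exp_times_lborel_pos[OF assms])
      have G: "integrable lborel_pos G"
      proof -
        \<comment> \<open>The factor \<open>exp (norm h * Y)\<close> moves \<open>q\<close> to the
          left by \<open>norm h\<close>; since \<open>norm h < R\<close>, this stays to the right of
          \<open>q0\<close>.\<close>
        have "laplace_exists f (q - of_real (norm h))"
          using assms by (rule laplace_exists_mono) (use h in \<open>simp add: R_def\<close>)
        then have "integrable lborel_pos
            (\<lambda>Y. norm (exp (- (q - of_real (norm h)) * complex_of_real Y) * f Y))"
          unfolding laplace_exists_iff by (rule integrable_norm)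
        also have "(\<lambda>Y. norm (exp (- (q - of_real (norm h)) * complex_of_real Y) * f Y)) = G"
          by (rule ext) (simp add: G_def F_def norm_mult algebra_simps flip: exp_add)
        finally show ?thesis .
      qed
      have ng: "norm (g n Y) = (norm h * Y) ^ n /\<^sub>R fact n * norm (F Y)" if "Y > 0" for n Y
        using that by (simp add: g_def norm_mult norm_divide norm_power power_mult_distrib field_simps)
      have sums_G: "(\<lambda>n. norm (g n Y)) sums G Y" if "Y > 0" for Y
        unfolding ng[OF that] G_def by (intro sums_mult2 exp_converges)
      have g_le: "norm (g n Y) \<le> G Y" if "Y > 0" for n Y
        using sums_G[OF that] sum_le_suminf[of "\<lambda>n. norm (g n Y)" "{n}"]
        by (simp add: sums_iff)
      have g_int: "integrable lborel_pos (g n)" for n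
      proof (rule Bochner_Integration.integrable_bound[OF G])
        show "g n \<in> borel_measurable lborel_pos"
        proof -
          have "(\<lambda>Y. complex_of_real ((- Y) ^ n / fact n)) \<in> borel_measurable lborel_pos"
            by (rule borel_measurable_lborel_pos) simp
          then show ?thesis
            unfolding g_def[abs_def] by (intro borel_measurable_times F borel_measurable_const)
        qed
        show "AE Y in lborel_pos. norm (g n Y) \<le> norm (G Y)"
          using g_le by (intro AE_lborel_pos) (auto simp: G_def)
      qed
      have "(\<lambda>n. integral\<^sup>L lborel_pos (g n)) sums (\<integral>Y. (\<Sum>n. g n Y) \<partial>lborel_pos)"
      proof (rule sums_integral[OF g_int])
        show "AE Y in lborel_pos. summable (\<lambda>n. norm (g n Y))"
          using sums_G by (intro AE_lborel_pos) (auto simp: sums_iff)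
        show "summable (\<lambda>n. \<integral>Y. norm (g n Y) \<partial>lborel_pos)"
        proof (rule summableI_nonneg_bounded)
          fix n
          have "(\<Sum>i<n. \<integral>Y. norm (g i Y) \<partial>lborel_pos) = (\<integral>Y. (\<Sum>i<n. norm (g i Y)) \<partial>lborel_pos)"
            using g_int by (subst Bochner_Integration.integral_sum) auto
          also have "\<dots> \<le> integral\<^sup>L lborel_pos G"
          proof (rule integral_mono_AE)
            show "AE Y in lborel_pos. (\<Sum>i<n. norm (g i Y)) \<le> G Y"
              using sums_G by (intro AE_lborel_pos) (metis sum_le_suminf sums_iff finite_lessThan norm_ge_zero)
          qed (use g_int G in auto)
          finally show "(\<Sum>i<n. \<integral>Y. norm (g i Y) \<partial>lborel_pos) \<le> integral\<^sup>L lborel_pos G" .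
        qed simp
      qed
      also have "(\<integral>Y. (\<Sum>n. g n Y) \<partial>lborel_pos) = laplace f w"
        unfolding laplace_eq
      proof (rule Bochner_Integration.integral_cong[OF refl])
        fix Y :: real
        have "(\<lambda>n. (- (h * of_real Y)) ^ n /\<^sub>R fact n * F Y) sums (exp (- (h * of_real Y)) * F Y)"
          by (intro sums_mult2 exp_converges)
        also have "(\<lambda>n. (- (h * of_real Y)) ^ n /\<^sub>R fact n * F Y) = (\<lambda>n. g n Y)"
          by (rule ext) (simp add: g_def scaleR_conv_of_real power_mult_distrib[symmetric] field_simps)
        also have "exp (- (h * of_real Y)) * F Y = exp (- w * of_real Y) * f Y"
          by (simp add: F_def h_def algebra_simps flip: exp_add)
        finally show "(\<Sum>n. g n Y) = exp (- w * complex_of_real Y) * f Y"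
          by (simp add: sums_iff)
      qed
      finally show ?thesis
        by (simp add: g_def[abs_def] a_def h_def)
    qed
    then have "laplace f holomorphic_on ball q R"
      by (rule power_series_holomorphic)
    moreover have "q \<in> ball q R"
      using q by (simp add: R_def)
    ultimately show ?thesis
      using holomorphic_on_imp_differentiable_at[OF _ open_ball] by blast
  qed
  then show ?thesis
    by (auto simp: holomorphic_on_def field_differentiable_at_within)
qed

section \<open>Laplace transforms of complex powers\<close>

lemma laplace_exists_powr:
  assumes "Re z > 0" and "Re q > 0"
  shows "laplace_exists (\<lambda>Y. complex_of_real Y powr (z - 1)) q"
proof -
  let ?f = "\<lambda>Y. complex_of_real Y powr (z - 1)"
  have "set_integrable lebesgue {0<..} (\<lambda>t. ?f t / of_real (exp (Re q * t)))"
    using absolutely_integrable_Gamma_integral[OF assms] .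
  then have "set_integrable lborel {0<..} (\<lambda>t. ?f t / of_real (exp (Re q * t)))"
    \<comment> \<open>Lebesgue measure is the completion of \<open>lborel\<close>; for a Borel
      integrand integrability is the same for both.\<close>
    unfolding set_integrable_def by (subst (asm) integrable_completion) auto
  then have "laplace_exists ?f (of_real (Re q))"
    unfolding laplace_exists_def
    by (simp add: field_simps exp_minus flip: exp_of_real)
  then show ?thesis
    by (rule laplace_exists_mono) simp
qed

text \<open>Substitution \<open>t = a Y\<close> in the Gamma integral. The indicator is built into
  \<open>g\<close>, so the substitution runs over the whole line; \<open>a > 0\<close> preserves the
  half-line.\<close>

lemma laplace_powr_real:
  assumes z: "Re z > 0" and a: "a > 0"
  shows "laplace (\<lambda>Y. complex_of_real Y powr (z - 1)) (of_real a) = Gamma z / of_real a powr z"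
proof -
  define g where "g t = indicator {0<..} t *\<^sub>R (exp (- complex_of_real t) * complex_of_real t powr (z - 1))"
    for t :: real
  have "set_integrable lborel {0<..} (\<lambda>t. exp (- complex_of_real t) * complex_of_real t powr (z - 1))"
    using laplace_exists_powr[OF z, of 1] by (simp add: laplace_exists_def)
  then have "(LINT t:{0<..}|lborel. exp (- complex_of_real t) * complex_of_real t powr (z - 1))
      = integral {0<..} (\<lambda>t. exp (- complex_of_real t) * complex_of_real t powr (z - 1))"
    by (rule set_borel_integral_eq_integral)
  also have "(\<lambda>t. exp (- complex_of_real t) * complex_of_real t powr (z - 1))
      = (\<lambda>t. of_real t powr (z - 1) / of_real (exp t))"
    by (rule ext) (simp add: field_simps exp_minus flip: exp_of_real)
  also have "integral {0<..} \<dots> = Gamma z"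
    by (rule integral_unique[OF Gamma_integral_complex'[OF z]])
  finally have "Gamma z = (\<integral>t. g t \<partial>lborel)"
    unfolding g_def set_lebesgue_integral_def
    by (simp add: field_simps exp_minus flip: exp_of_real)
  also have "\<dots> = \<bar>a\<bar> *\<^sub>R (\<integral>t. g (0 + a * t) \<partial>lborel)"
    by (rule lborel_integral_real_affine) (use a in simp)
  also have "(\<lambda>t. g (0 + a * t)) = (\<lambda>t. of_real a powr (z - 1) *
      (indicator {0<..} t *\<^sub>R (exp (- of_real a * complex_of_real t) * complex_of_real t powr (z - 1))))"
    using a by (auto simp: g_def fun_eq_iff indicator_def zero_less_mult_iff powr_times_real algebra_simps)
  also have "(\<integral>t. \<dots> t \<partial>lborel) = of_real a powr (z - 1) * laplace (\<lambda>Y. complex_of_real Y powr (z - 1)) (of_real a)"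
    by (simp add: laplace_def set_lebesgue_integral_def flip: mult_scaleR_right)
  finally have "Gamma z = of_real a powr z * laplace (\<lambda>Y. complex_of_real Y powr (z - 1)) (of_real a)"
    using a by (simp add: scaleR_conv_of_real powr_diff)
  then show ?thesis
    using a by (simp add: field_simps)
qed

text \<open>Identity theorem: both sides are holomorphic in the right half-plane and agree on the
  positive reals, which accumulate at 1.\<close>

lemma laplace_powr:
  assumes z: "Re z > 0" and q: "Re q > 0"
  shows "laplace (\<lambda>Y. complex_of_real Y powr (z - 1)) q = Gamma z / q powr z"
proof -
  let ?L = "laplace (\<lambda>Y. complex_of_real Y powr (z - 1))"
  let ?S = "{q. Re q > 0}"
  have "?L q - Gamma z / q powr z = 0"
  proof (rule analytic_continuation[where f = "\<lambda>q. ?L q - Gamma z / q powr z"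
        and S = ?S and w = q and U = "complex_of_real ` {0<..}" and \<xi> = 1])
    have "?L field_differentiable at p" if "Re p > 0" for p
    proof -
      \<comment> \<open>Holomorphy holds strictly to the right of a point of existence, so a point
        halfway between \<open>p\<close> and the imaginary axis serves as base.\<close>
      have "?L holomorphic_on {q. Re q > Re (of_real (Re p / 2))}"
        by (rule holomorphic_laplace[OF laplace_exists_powr[OF z]]) (use that in simp)
      then show ?thesis
        using that
        by (intro holomorphic_on_imp_differentiable_at[of ?L "{q. Re q > Re (of_real (Re p / 2))}"]
            open_halfspace_Re_gt) auto
    qed
    then have "?L holomorphic_on ?S"
      by (auto simp: holomorphic_on_def field_differentiable_at_within)
    moreover have "p \<notin> \<real>\<^sub>\<le>\<^sub>0" if "p \<in> ?S" for p
      using that by (auto simp: complex_nonpos_Reals_iff)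
    ultimately show "(\<lambda>q. ?L q - Gamma z / q powr z) holomorphic_on ?S"
      by (intro holomorphic_intros) auto
    show "open ?S" "connected ?S"
      by (auto simp: open_halfspace_Re_gt intro!: convex_connected convex_halfspace_Re_gt)
    show "1 islimpt complex_of_real ` {0<..}"
    proof -
      have "(\<lambda>n. complex_of_real (1 + 1 / real (Suc n))) \<longlonglongrightarrow> of_real (1 + 0)"
        by (intro tendsto_intros LIMSEQ_Suc[OF lim_1_over_n])
      moreover have "complex_of_real (1 + 1 / real (Suc n)) \<in> complex_of_real ` {0<..} - {1}" for n
      proof -
        have "1 + 1 / real (Suc n) > 0" "1 + 1 / real (Suc n) \<noteq> 1"
          by (auto simp: add_pos_pos simp del: of_nat_Suc)
        then show ?thesis
          by (metis DiffI greaterThan_iff imageI of_real_eq_1_iff singletonD)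
      qed
      ultimately show ?thesis
        unfolding islimpt_sequential
        by (intro exI[of _ "\<lambda>n. complex_of_real (1 + 1 / real (Suc n))"]) simp
    qed
  qed (use q laplace_powr_real[OF z] in auto)
  then show ?thesis
    by simp
qed

text \<open>For \<open>Y > 0\<close> the norm of the integrand is the same integrand with
  \<open>z\<close> and \<open>q\<close> replaced by their real parts, so the real case gives the
  exact L1 norm.\<close>

lemma integral_norm_laplace_powr:
  assumes z: "Re z > 0" and q: "Re q > 0"
  shows "(\<integral>Y. norm (exp (- q * complex_of_real Y) * complex_of_real Y powr (z - 1)) \<partial>lborel_pos)
           = Gamma (Re z) / Re q powr Re z"
proof -
  have "complex_of_real (\<integral>Y. norm (exp (- q * complex_of_real Y) * complex_of_real Y powr (z - 1)) \<partial>lborel_pos)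
      = (\<integral>Y. complex_of_real (norm (exp (- q * complex_of_real Y) * complex_of_real Y powr (z - 1))) \<partial>lborel_pos)"
    by (rule integral_complex_of_real[symmetric])
  also have "\<dots> = laplace (\<lambda>Y. complex_of_real Y powr (of_real (Re z) - 1)) (of_real (Re q))"
    unfolding laplace_eq
  proof (rule Bochner_Integration.integral_cong[OF refl])
    fix Y assume "Y \<in> space lborel_pos"
    then have "Y > 0"
      by (simp add: space_restrict_space)
    then show "complex_of_real (norm (exp (- q * complex_of_real Y) * complex_of_real Y powr (z - 1)))
        = exp (- of_real (Re q) * complex_of_real Y) * complex_of_real Y powr (of_real (Re z) - 1)"
      using powr_of_real[of Y "Re z - 1"]
      by (simp add: norm_mult norm_powr_real_powr flip: exp_of_real)
  qed
  also have "\<dots> = complex_of_real (Gamma (Re z) / Re q powr Re z)"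
    using z q powr_of_real[of "Re q" "Re z"] by (subst laplace_powr_real) (auto simp: Gamma_complex_of_real)
  finally show ?thesis
    by (simp only: of_real_eq_iff)
qed

subsection \<open>Interchanging double series and integrals\<close>

text \<open>Tonelli in \<open>ennreal\<close>: the integral of the sum of norms is finite, so that
  sum is finite almost everywhere.\<close>

lemma AE_summable_norm:
  fixes f :: "nat \<Rightarrow> 'a \<Rightarrow> 'b :: {banach, second_countable_topology}"
  assumes "\<And>i. integrable M (f i)" and "summable (\<lambda>i. \<integral>x. norm (f i x) \<partial>M)"
  shows "AE x in M. summable (\<lambda>i. norm (f i x))"
proof -
  have meas: "(\<lambda>x. ennreal (norm (f i x))) \<in> borel_measurable M" for i
    using borel_measurable_integrable[OF assms(1)] by measurable
  have "(\<integral>\<^sup>+x. (\<Sum>i. ennreal (norm (f i x))) \<partial>M) = (\<Sum>i. \<integral>\<^sup>+x. ennreal (norm (f i x)) \<partial>M)"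
    by (rule nn_integral_suminf[OF meas])
  also have "\<dots> = (\<Sum>i. ennreal (\<integral>x. norm (f i x) \<partial>M))"
    using assms(1) by (subst nn_integral_eq_integral) auto
  also have "\<dots> = ennreal (\<Sum>i. \<integral>x. norm (f i x) \<partial>M)"
    using assms(2) by (intro suminf_ennreal2) auto
  finally have "(\<integral>\<^sup>+x. (\<Sum>i. ennreal (norm (f i x))) \<partial>M) \<noteq> \<infinity>"
    by simp
  then have "AE x in M. (\<Sum>i. ennreal (norm (f i x))) \<noteq> \<infinity>"
    by (intro nn_integral_PInf_AE borel_measurable_suminf_order meas)
  then show ?thesis
    by eventually_elim (auto intro: summable_suminf_not_top)
qed

text \<open>Triangle inequality in L1 for series; it supplies the summability of the outer series
  below.\<close>

lemma integral_norm_suminf_le: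
  fixes f :: "nat \<Rightarrow> 'a \<Rightarrow> 'b :: {banach, second_countable_topology}"
  assumes "\<And>i. integrable M (f i)" and "summable (\<lambda>i. \<integral>x. norm (f i x) \<partial>M)"
  shows "(\<integral>x. norm (\<Sum>i. f i x) \<partial>M) \<le> (\<Sum>i. \<integral>x. norm (f i x) \<partial>M)"
proof -
  note AE = AE_summable_norm[OF assms]
  have int: "integrable M (\<lambda>x. norm (f i x))" for i
    using assms(1) by (rule integrable_norm)
  have AE': "AE x in M. summable (\<lambda>i. norm (norm (f i x)))"
    using AE by simp
  have sum': "summable (\<lambda>i. \<integral>x. norm (norm (f i x)) \<partial>M)"
    using assms(2) by simp
  have "(\<integral>x. norm (\<Sum>i. f i x) \<partial>M) \<le> (\<integral>x. (\<Sum>i. norm (f i x)) \<partial>M)"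
  proof (rule integral_mono_AE)
    show "integrable M (\<lambda>x. norm (\<Sum>i. f i x))"
      using integrable_suminf[OF assms(1) AE assms(2)] by (rule integrable_norm)
    show "integrable M (\<lambda>x. \<Sum>i. norm (f i x))"
      by (rule integrable_suminf[OF int AE' sum'])
    show "AE x in M. norm (\<Sum>i. f i x) \<le> (\<Sum>i. norm (f i x))"
      using AE by eventually_elim (rule summable_norm)
  qed
  also have "\<dots> = (\<Sum>i. \<integral>x. norm (f i x) \<partial>M)"
    by (rule integral_suminf[OF int AE' sum'])
  finally show ?thesis .
qed

text \<open>Termwise integration applied twice: first to each inner series, then to the series of
  inner sums, whose L1 norms are dominated by \<open>outer\<close>. The almost-everywhere
  summability is stated too, since constants are later pulled out of both sums pointwise.\<close>

lemma
  fixes f :: "nat \<Rightarrow> nat \<Rightarrow> 'a \<Rightarrow> 'b :: {banach, second_countable_topology}"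
  assumes int: "\<And>s r. integrable M (f s r)"
    and inner: "\<And>s. summable (\<lambda>r. \<integral>x. norm (f s r x) \<partial>M)"
    and outer: "summable (\<lambda>s. \<Sum>r. \<integral>x. norm (f s r x) \<partial>M)"
  shows integrable_double_suminf: "integrable M (\<lambda>x. \<Sum>s. \<Sum>r. f s r x)"
    and integral_double_suminf:
      "(\<integral>x. (\<Sum>s. \<Sum>r. f s r x) \<partial>M) = (\<Sum>s. \<Sum>r. \<integral>x. f s r x \<partial>M)"
    and AE_summable_double:
      "AE x in M. (\<forall>s. summable (\<lambda>r. f s r x)) \<and> summable (\<lambda>s. \<Sum>r. f s r x)"
proof -
  note AE_in = AE_summable_norm[OF int inner]
  note int_in = integrable_suminf[OF int AE_in inner]
  have sum_out: "summable (\<lambda>s. \<integral>x. norm (\<Sum>r. f s r x) \<partial>M)"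
  proof (rule summable_comparison_test'[OF outer])
    show "norm (\<integral>x. norm (\<Sum>r. f s r x) \<partial>M) \<le> (\<Sum>r. \<integral>x. norm (f s r x) \<partial>M)" for s
      using integral_norm_suminf_le[OF int inner, of s] by simp
  qed
  note AE_out = AE_summable_norm[OF int_in sum_out]
  show "integrable M (\<lambda>x. \<Sum>s. \<Sum>r. f s r x)"
    by (rule integrable_suminf[OF int_in AE_out sum_out])
  show "(\<integral>x. (\<Sum>s. \<Sum>r. f s r x) \<partial>M) = (\<Sum>s. \<Sum>r. \<integral>x. f s r x \<partial>M)"
    unfolding integral_suminf[OF int_in AE_out sum_out]
    by (intro suminf_cong integral_suminf[OF int AE_in inner])
  have "AE x in M. \<forall>s. summable (\<lambda>r. norm (f s r x))"
    using AE_in by (simp add: AE_all_countable)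
  with AE_out show "AE x in M. (\<forall>s. summable (\<lambda>r. f s r x)) \<and> summable (\<lambda>s. \<Sum>r. f s r x)"
    by eventually_elim (blast intro: summable_norm_cancel)
qed

subsection \<open>Termwise Laplace transform of the H--K function\<close>

lemma pochhammer_nonzero_if_Re_pos:
  fixes z :: complex
  assumes "Re z > 0"
  shows "pochhammer z n \<noteq> 0"
  using not_nonpos_Ints_if_Re_pos[OF assms] pochhammer_eq_0_imp_nonpos_Int by blast

text \<open>Duplication splits \<open>pochhammer \<gamma>1 (2 * s)\<close> into \<open>4 ^ s\<close>
  and two factors, one of which is the \<gamma>3-factor; likewise
  \<open>pochhammer \<gamma>2 (s + r)\<close> begins with the \<gamma>4-factor. The
  \<open>4 ^ s\<close> is the origin of the 4 in the Prabhakar argument.\<close>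

lemma HK_coefficient:
  fixes \<gamma>1 \<gamma>2 X :: complex
  assumes "Re \<gamma>1 > 0" and "Re \<gamma>2 > 0"
  shows "pochhammer \<gamma>1 (2 * s) * pochhammer \<gamma>2 (s + r) * X ^ s
            / (pochhammer ((\<gamma>1 + 1) / 2) s * pochhammer \<gamma>2 s)
         = pochhammer (\<gamma>1 / 2) s * (4 * X) ^ s * pochhammer (\<gamma>2 + of_nat s) r"
proof -
  have "pochhammer ((\<gamma>1 + 1) / 2) s \<noteq> 0" "pochhammer \<gamma>2 s \<noteq> 0"
    using assms by (auto intro!: pochhammer_nonzero_if_Re_pos)
  moreover have "pochhammer \<gamma>1 (2 * s) = 4 ^ s * pochhammer (\<gamma>1 / 2) s * pochhammer ((\<gamma>1 + 1) / 2) s"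
    using pochhammer_double[of "\<gamma>1 / 2" s] by (simp add: power_mult add_divide_distrib)
  ultimately show ?thesis
    by (simp add: pochhammer_product' power_mult_distrib)
qed

text \<open>The condition \<open>small\<close> is what makes the absolute majorant converge: it
  involves \<open>Re q\<close> and the growth rate \<open>K\<close> of the Gamma quotients. The
  condition on \<open>w powr \<upsilon> / q powr \<upsilon>\<close> enters when the signed
  \<open>r\<close>-series is evaluated.\<close>

lemma
  fixes \<gamma>1 \<gamma>2 \<kappa> \<rho> \<upsilon> X w q :: complex and f :: "real \<Rightarrow> complex"
  assumes pos: "Re \<gamma>1 > 0" "Re \<gamma>2 > 0" "Re \<kappa> > 0" "Re \<rho> > 0" "Re \<upsilon> > 0" and q: "Re q > 0"
    and MK: "M > 0" "K > 0"
      "\<And>r. Gamma (Re (\<rho> + \<upsilon> * of_nat r)) \<le> M * K ^ r * norm (Gamma (\<rho> + \<upsilon> * of_nat r))"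
    and small: "K * norm (w powr \<upsilon>) < Re q powr Re \<upsilon>"
  defines "f \<equiv> \<lambda>Y. complex_of_real Y powr (\<rho> - 1) *
             HK_mittag_leffler \<kappa> \<rho> \<upsilon> \<gamma>1 \<gamma>2 ((\<gamma>1 + 1) / 2) \<gamma>2 X (w * complex_of_real Y)"
  shows laplace_exists_HK: "laplace_exists f q"
    and laplace_HK: "norm (w powr \<upsilon> / q powr \<upsilon>) < 1 \<Longrightarrow>
      laplace f q = 1 / q powr \<rho> * (1 - w powr \<upsilon> / q powr \<upsilon>) powr (- \<gamma>2) *
        prabhakar 1 \<kappa> (\<gamma>1 / 2) (4 * X / (1 - w powr \<upsilon> / q powr \<upsilon>))"
proof -
  define W where "W = w powr \<upsilon>"
  define A where "A s = pochhammer (\<gamma>1 / 2) s * (4 * X) ^ s / (Gamma (\<kappa> + of_nat s) * fact s)" for s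
  define x where "x r = \<rho> + \<upsilon> * of_nat r" for r :: nat
  define c where "c s r = A s * (pochhammer (\<gamma>2 + of_nat s) r * W ^ r / (Gamma (x r) * fact r))" for s r
  define g where "g s r Y = c s r * (exp (- q * complex_of_real Y) * complex_of_real Y powr (x r - 1))"
    for s r Y
  \<comment> \<open>Ratio of the majorant: \<open>K\<close> comes from the Gamma quotient,
    \<open>norm W\<close> from the coefficient and the denominator from the L1 norm of the
    power.\<close>
  define \<zeta> where "\<zeta> = K * norm W / Re q powr Re \<upsilon>"
  define D where "D s = norm (A s) * (M / Re q powr Re \<rho>)" for s
  have x: "Re (x r) > 0" for r
    using pos by (simp add: x_def add_pos_nonneg)
  have Gx: "Gamma (x r) \<noteq> 0" for r
    using not_nonpos_Ints_if_Re_pos[OF x] by (simp add: Gamma_eq_zero_iff)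
  have \<zeta>: "0 \<le> \<zeta>" "\<zeta> < 1"
    using small q MK by (auto simp: \<zeta>_def W_def)
  have int: "integrable lborel_pos (g s r)" for s r
    using laplace_exists_powr[OF x q, unfolded laplace_exists_iff] by (simp add: g_def[abs_def])
  have norm_g: "(\<integral>Y. norm (g s r Y) \<partial>lborel_pos)
      = norm (c s r) * (Gamma (Re (x r)) / Re q powr Re (x r))" for s r
    using integral_norm_laplace_powr[OF x q, of r] by (simp add: g_def norm_mult[of "c s r"])
  have norm_g_le: "(\<integral>Y. norm (g s r Y) \<partial>lborel_pos)
      \<le> D s * (pochhammer (norm \<gamma>2 + real s) r / fact r * \<zeta> ^ r)" for s r
  proof -
    have "norm (pochhammer (\<gamma>2 + of_nat s) r) \<le> pochhammer (norm (\<gamma>2 + of_nat s)) r"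
      by (rule norm_pochhammer_le)
    also have "\<dots> \<le> pochhammer (norm \<gamma>2 + real s) r"
      unfolding pochhammer_prod by (intro prod_mono) (auto intro: norm_triangle_le)
    finally have 1: "norm (pochhammer (\<gamma>2 + of_nat s) r) \<le> pochhammer (norm \<gamma>2 + real s) r" .
    have 2: "Gamma (Re (x r)) / norm (Gamma (x r)) \<le> M * K ^ r"
      using MK(3)[of r] Gx[of r] by (simp add: x_def field_simps)
    have "(\<integral>Y. norm (g s r Y) \<partial>lborel_pos) =
        (norm (A s) * norm W ^ r / fact r / Re q powr Re (x r)) *
        (norm (pochhammer (\<gamma>2 + of_nat s) r) * (Gamma (Re (x r)) / norm (Gamma (x r))))"
      unfolding norm_g by (simp add: c_def norm_mult norm_divide norm_power mult_ac)
    also have "\<dots> \<le> (norm (A s) * norm W ^ r / fact r / Re q powr Re (x r)) *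
        (pochhammer (norm \<gamma>2 + real s) r * (M * K ^ r))"
      using 1 2 x[of r] order_trans[OF norm_ge_zero 1]
      by (intro mult_left_mono mult_mono) (auto intro!: divide_nonneg_nonneg Gamma_real_nonneg)
    also have "Re q powr Re (x r) = Re q powr Re \<rho> * (Re q powr Re \<upsilon>) ^ r"
      using q by (simp add: x_def powr_add powr_powr flip: powr_realpow)
    finally show ?thesis
      by (simp add: D_def \<zeta>_def power_mult_distrib power_divide mult_ac)
  qed
  have bound_sums: "(\<lambda>r. D s * (pochhammer (norm \<gamma>2 + real s) r / fact r * \<zeta> ^ r))
      sums (D s * (1 - \<zeta>) powr (- (norm \<gamma>2 + real s)))" for s
    using \<zeta> by (intro sums_mult pochhammer_binomial_sums_real) simp
  have inner: "summable (\<lambda>r. \<integral>Y. norm (g s r Y) \<partial>lborel_pos)" for s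
    by (rule summable_comparison_test'[OF sums_summable[OF bound_sums[of s]]]) (use norm_g_le in simp)
  have outer: "summable (\<lambda>s. \<Sum>r. \<integral>Y. norm (g s r Y) \<partial>lborel_pos)"
  proof (rule summable_comparison_test')
    \<comment> \<open>Summing the majorant over \<open>r\<close> leaves a factor
      \<open>(1 - \<zeta>) ^ s\<close> in the denominator. It merges with
      \<open>(4 * X) ^ s\<close>, so the outer majorant is a Prabhakar series, convergent at any
      argument.\<close>
    show "summable (\<lambda>s. (M / Re q powr Re \<rho> * (1 - \<zeta>) powr (- norm \<gamma>2)) *
        norm (pochhammer (\<gamma>1 / 2) s * (4 * X / of_real (1 - \<zeta>)) ^ s / (Gamma (\<kappa> + of_nat s) * fact s)))"
      by (intro summable_mult summable_prabhakar pos)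
    fix s
    have "(\<Sum>r. \<integral>Y. norm (g s r Y) \<partial>lborel_pos) \<le> D s * (1 - \<zeta>) powr (- (norm \<gamma>2 + real s))"
      using suminf_le[OF norm_g_le inner sums_summable[OF bound_sums[of s]]] bound_sums[of s]
      by (simp add: sums_iff)
    also have "(1 - \<zeta>) powr (- (norm \<gamma>2 + real s)) = (1 - \<zeta>) powr (- norm \<gamma>2) / (1 - \<zeta>) ^ s"
      using \<zeta> by (simp add: powr_diff powr_realpow)
    also have "D s * \<dots> = (M / Re q powr Re \<rho> * (1 - \<zeta>) powr (- norm \<gamma>2)) *
        norm (pochhammer (\<gamma>1 / 2) s * (4 * X / of_real (1 - \<zeta>)) ^ s / (Gamma (\<kappa> + of_nat s) * fact s))"
    proof -
      have "norm (1 - complex_of_real \<zeta>) = 1 - \<zeta>"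
        using \<zeta> norm_of_real[of "1 - \<zeta>", where 'a = complex] by simp
      then show ?thesis
        by (simp add: D_def A_def norm_mult norm_divide norm_power power_divide mult_ac)
    qed
    finally show "norm (\<Sum>r. \<integral>Y. norm (g s r Y) \<partial>lborel_pos) \<le> \<dots>"
      using inner by (simp add: suminf_nonneg)
  qed
  have f_eq: "AE Y in lborel_pos. exp (- q * complex_of_real Y) * f Y = (\<Sum>s. \<Sum>r. g s r Y)"
    using AE_summable_double[OF int inner outer] AE_lborel_pos[of "\<lambda>Y. Y > 0", simplified]
  proof eventually_elim
    case (elim Y)
    then have Y: "Y > 0" and sum_r: "\<And>s. summable (\<lambda>r. g s r Y)" and sum_s: "summable (\<lambda>s. \<Sum>r. g s r Y)"
      by auto
    define k where "k = exp (- q * complex_of_real Y) * complex_of_real Y powr (\<rho> - 1)"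
    \<comment> \<open>Being nonzero, \<open>k\<close> can be cancelled, which transfers summability
      from \<open>g\<close> to the H--K terms \<open>h\<close>; pulling \<open>k\<close> out of the
      sums requires it.\<close>
    have k: "k \<noteq> 0"
      using Y by (simp add: k_def)
    define h where "h s r = pochhammer \<gamma>1 (2 * s) * pochhammer \<gamma>2 (s + r) * X ^ s *
       ((w * complex_of_real Y) powr \<upsilon>) ^ r / (pochhammer ((\<gamma>1 + 1) / 2) s * pochhammer \<gamma>2 s *
         Gamma (\<kappa> + of_nat s) * Gamma (\<rho> + \<upsilon> * of_nat r) * fact r * fact s)" for s r
    have g: "g s r Y = k * h s r" for s r
    proof -
      have "(w * complex_of_real Y) powr \<upsilon> = W * complex_of_real Y powr \<upsilon>"
        using Y powr_times_real_left[of "complex_of_real Y" w \<upsilon>] by (simp add: W_def mult.commute)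
      then have "h s r = (pochhammer \<gamma>1 (2 * s) * pochhammer \<gamma>2 (s + r) * X ^ s
            / (pochhammer ((\<gamma>1 + 1) / 2) s * pochhammer \<gamma>2 s)) *
          (W ^ r * (complex_of_real Y powr \<upsilon>) ^ r /
            (Gamma (\<kappa> + of_nat s) * Gamma (x r) * fact r * fact s))"
        by (simp add: h_def x_def power_mult_distrib mult_ac)
      also have "\<dots> = c s r * (complex_of_real Y powr \<upsilon>) ^ r"
        unfolding HK_coefficient[OF pos(1,2)] by (simp add: c_def A_def mult_ac)
      finally have "k * h s r = c s r * (exp (- q * complex_of_real Y) *
          (complex_of_real Y powr (\<rho> - 1) * (complex_of_real Y powr \<upsilon>) ^ r))"
        by (simp add: k_def)
      also have "complex_of_real Y powr (\<rho> - 1) * (complex_of_real Y powr \<upsilon>) ^ r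
          = complex_of_real Y powr (x r - 1)"
        using Y by (simp add: x_def powr_def algebra_simps flip: exp_of_nat_mult exp_add)
      finally show ?thesis
        by (simp add: g_def)
    qed
    have hr: "summable (h s)" for s
      using sum_r[of s] k by (simp add: g)
    then have gr: "(\<Sum>r. g s r Y) = k * (\<Sum>r. h s r)" for s
      by (simp add: g suminf_mult)
    then have "summable (\<lambda>s. \<Sum>r. h s r)"
      using sum_s k by simp
    then have "(\<Sum>s. \<Sum>r. g s r Y) = k * (\<Sum>s. \<Sum>r. h s r)"
      by (simp add: gr suminf_mult)
    then show ?case
      by (simp add: f_def k_def h_def HK_mittag_leffler_def)
  qed
  have meas: "(\<lambda>Y. exp (- q * complex_of_real Y) * f Y) \<in> borel_measurable lborel_pos"
    unfolding f_def HK_mittag_leffler_def by (rule borel_measurable_lborel_pos) measurable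
  have meas': "(\<lambda>Y. \<Sum>s. \<Sum>r. g s r Y) \<in> borel_measurable lborel_pos"
    using integrable_double_suminf[OF int inner outer] by (rule borel_measurable_integrable)
  show "laplace_exists f q"
    unfolding laplace_exists_iff integrable_cong_AE[OF meas meas' f_eq]
    by (rule integrable_double_suminf[OF int inner outer])
  assume z: "norm (w powr \<upsilon> / q powr \<upsilon>) < 1"
  define z where "z = w powr \<upsilon> / q powr \<upsilon>"
  have z: "norm z < 1" "1 - z \<noteq> 0"
    using z by (auto simp: z_def)
  have q0: "q \<noteq> 0"
    using q by auto
  have term_g: "(\<integral>Y. g s r Y \<partial>lborel_pos)
      = A s / q powr \<rho> * (pochhammer (\<gamma>2 + of_nat s) r / fact r * z ^ r)" for s r
  proof -
    have "(\<integral>Y. g s r Y \<partial>lborel_pos) = c s r * (Gamma (x r) / q powr x r)"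
      using laplace_powr[OF x q, of r] by (simp add: g_def laplace_eq)
    \<comment> \<open>No branch problem: all exponents multiply the same principal logarithm of
      \<open>q\<close>.\<close>
    also have "q powr x r = q powr \<rho> * (q powr \<upsilon>) ^ r"
      using q0 by (simp add: x_def powr_def ring_distribs exp_add mult_ac flip: exp_of_nat_mult)
    finally show ?thesis
      using Gx[of r] by (simp add: c_def z_def W_def power_divide)
  qed
  have inner_g: "(\<Sum>r. A s / q powr \<rho> * (pochhammer (\<gamma>2 + of_nat s) r / fact r * z ^ r))
      = 1 / q powr \<rho> * (1 - z) powr (- \<gamma>2) *
        (pochhammer (\<gamma>1 / 2) s * (4 * X / (1 - z)) ^ s / (Gamma (\<kappa> + of_nat s) * fact s))" for s
  proof -
    have "(\<lambda>r. A s / q powr \<rho> * (pochhammer (\<gamma>2 + of_nat s) r / fact r * z ^ r))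
        sums (A s / q powr \<rho> * (1 - z) powr (- (\<gamma>2 + of_nat s)))"
      by (intro sums_mult pochhammer_binomial_sums_complex z)
    \<comment> \<open>The integer part \<open>s\<close> of the exponent becomes an ordinary power
      and rescales the argument from \<open>4 * X\<close> to \<open>4 * X / (1 - z)\<close>.\<close>
    moreover have "(1 - z) powr (- (\<gamma>2 + of_nat s)) = (1 - z) powr (- \<gamma>2) / (1 - z) ^ s"
      using z by (simp add: powr_diff powr_nat)
    ultimately show ?thesis
      by (simp add: sums_iff A_def power_divide mult_ac)
  qed
  have "laplace f q = (\<integral>Y. (\<Sum>s. \<Sum>r. g s r Y) \<partial>lborel_pos)"
    unfolding laplace_eq by (rule integral_cong_AE[OF meas meas' f_eq])
  also have "\<dots> = (\<Sum>s. \<Sum>r. \<integral>Y. g s r Y \<partial>lborel_pos)"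
    by (rule integral_double_suminf[OF int inner outer])
  also have "\<dots> = (\<Sum>s. 1 / q powr \<rho> * (1 - z) powr (- \<gamma>2) *
        (pochhammer (\<gamma>1 / 2) s * (4 * X / (1 - z)) ^ s / (Gamma (\<kappa> + of_nat s) * fact s)))"
    unfolding term_g inner_g ..
  also have "\<dots> = 1 / q powr \<rho> * (1 - z) powr (- \<gamma>2) * prabhakar 1 \<kappa> (\<gamma>1 / 2) (4 * X / (1 - z))"
    by (rule sums_unique[symmetric, OF sums_mult[OF prabhakar_sums[OF pos(3)]]])
  finally show "laplace f q = 1 / q powr \<rho> * (1 - w powr \<upsilon> / q powr \<upsilon>) powr (- \<gamma>2) *
      prabhakar 1 \<kappa> (\<gamma>1 / 2) (4 * X / (1 - w powr \<upsilon> / q powr \<upsilon>))"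
    by (simp add: z_def)
qed

subsection \<open>Analytic continuation\<close>

lemma less_powr_if_root_less:
  fixes a b t :: real
  assumes "a > 0" and "b \<ge> 0" and "t > b powr (1 / a)"
  shows "b < t powr a"
proof -
  have "(b powr (1 / a)) powr a < t powr a"
    using assms by (intro powr_less_mono2) auto
  then show ?thesis
    using assms by (simp add: powr_powr)
qed

text \<open>The modulus of \<open>p powr \<upsilon>\<close> is that of \<open>p\<close> to the power
  \<open>Re \<upsilon>\<close>, times \<open>exp (- Im \<upsilon> * Arg p)\<close>, and the argument
  is at most pi. Hence \<open>norm (w powr \<upsilon> / p powr \<upsilon>) < 1\<close> far to the
  right.\<close>

lemma norm_powr_ge_Re:
  fixes p \<upsilon> :: complex
  assumes "Re p > 0" and "Re \<upsilon> > 0"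
  shows "Re p powr Re \<upsilon> * exp (- (\<bar>Im \<upsilon>\<bar> * pi)) \<le> norm (p powr \<upsilon>)"
proof -
  have "Im \<upsilon> * Arg p \<le> \<bar>Im \<upsilon>\<bar> * pi"
  proof -
    have "Im \<upsilon> * Arg p \<le> \<bar>Im \<upsilon>\<bar> * \<bar>Arg p\<bar>"
      by (metis abs_ge_self abs_mult)
    also have "\<dots> \<le> \<bar>Im \<upsilon>\<bar> * pi"
      using Arg_bounded[of p] by (intro mult_left_mono) auto
    finally show ?thesis .
  qed
  then show ?thesis
    unfolding norm_powr_complex using assms
    by (intro mult_mono powr_mono2 complex_Re_le_cmod) auto
qed

text \<open>Outward scaling keeps the argument of \<open>p\<close> and multiplies the modulus of the
  power by \<open>\<mu> powr Re \<upsilon> \<ge> 1\<close>.\<close>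

lemma norm_divide_powr_ray:
  fixes p \<upsilon> W :: complex
  assumes "Re \<upsilon> > 0" and "\<mu> \<ge> 1"
  shows "norm (W / (of_real \<mu> * p) powr \<upsilon>) \<le> norm (W / p powr \<upsilon>)"
proof (cases "p = 0")
  case False
  have "norm ((of_real \<mu> * p) powr \<upsilon>) = \<mu> powr Re \<upsilon> * norm (p powr \<upsilon>)"
    using assms by (simp add: powr_times_real_left norm_mult norm_powr_real_powr)
  moreover have "\<mu> powr Re \<upsilon> \<ge> 1"
    using assms by (simp add: ge_one_powr_ge_zero)
  ultimately have "norm (p powr \<upsilon>) \<le> norm ((of_real \<mu> * p) powr \<upsilon>)"
    using mult_right_mono[of 1 "\<mu> powr Re \<upsilon>" "norm (p powr \<upsilon>)"] by simp
  then show ?thesis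
    using False by (simp only: norm_divide) (intro divide_left_mono mult_pos_pos, auto)
qed auto

text \<open>Each point is joined inside the set to a far half-plane by the ray through it from the origin.\<close>

lemma connected_powr_region:
  fixes \<upsilon> W :: complex and c c' :: real
  assumes "Re \<upsilon> > 0" and "0 \<le> c" and "c \<le> c'"
    and far: "\<And>p. Re p > c' \<Longrightarrow> norm (W / p powr \<upsilon>) < 1"
  shows "connected {p. Re p > c \<and> norm (W / p powr \<upsilon>) < 1}" (is "connected ?S")
proof -
  define H where "H = {p. Re p > c'}"
  \<comment> \<open>Chosen so that \<open>\<Lambda> p * Re p \<ge> c' + 1\<close>: the stretched
    point lies in \<open>H\<close>.\<close>
  define \<Lambda> where "\<Lambda> p = max 1 ((c' + 1) / Re p)" for p
  define seg where "seg p = closed_segment p (of_real (\<Lambda> p) * p)" for p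
  have "H \<subseteq> ?S"
    using assms by (auto simp: H_def)
  have ne: "of_real (c' + 1) \<in> H"
    by (simp add: H_def)
  have \<Lambda>: "\<Lambda> p \<ge> 1" "of_real (\<Lambda> p) * p \<in> H" if "p \<in> ?S" for p
  proof -
    have "Re p > 0"
      using that assms by auto
    then have "(c' + 1) / Re p * Re p \<le> \<Lambda> p * Re p"
      by (intro mult_right_mono) (auto simp: \<Lambda>_def)
    then show "of_real (\<Lambda> p) * p \<in> H"
      using \<open>Re p > 0\<close> by (simp add: H_def)
  qed (simp add: \<Lambda>_def)
  have seg: "seg p \<subseteq> ?S" if p: "p \<in> ?S" for p
  proof
    fix v assume "v \<in> seg p"
    then obtain u where u: "0 \<le> u" "u \<le> 1" "v = (1 - u) *\<^sub>R p + u *\<^sub>R (of_real (\<Lambda> p) * p)"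
      by (auto simp: seg_def closed_segment_def)
    define \<mu> where "\<mu> = 1 + u * (\<Lambda> p - 1)"
    have v: "v = of_real \<mu> * p"
      by (simp add: u \<mu>_def scaleR_conv_of_real algebra_simps)
    have \<mu>: "\<mu> \<ge> 1"
      using u \<Lambda>(1)[OF p] by (simp add: \<mu>_def)
    have "1 * Re p \<le> \<mu> * Re p"
      using \<mu> p assms by (intro mult_right_mono) auto
    then show "v \<in> ?S"
      using norm_divide_powr_ray[OF assms(1) \<mu>, of W p] p by (auto simp: v)
  qed
  \<comment> \<open>All these connected sets share the nonempty half-plane \<open>H\<close>.\<close>
  have "connected (\<Union>p\<in>?S. H \<union> seg p)"
  proof (rule connected_Union)
    show "connected t" if "t \<in> (\<lambda>p. H \<union> seg p) ` ?S" for t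
    proof -
      from that obtain p where p: "p \<in> ?S" "t = H \<union> seg p"
        by blast
      have "H \<inter> seg p \<noteq> {}"
        using \<Lambda>(2)[OF p(1)] by (auto simp: seg_def)
      moreover have "connected H" "connected (seg p)"
        by (auto simp: H_def seg_def intro: convex_connected convex_halfspace_Re_gt)
      ultimately show ?thesis
        unfolding p(2) by (intro connected_Un)
    qed
    show "\<Inter>((\<lambda>p. H \<union> seg p) ` ?S) \<noteq> {}"
      using ne by blast
  qed
  also have "(\<Union>p\<in>?S. H \<union> seg p) = ?S"
    using \<open>H \<subseteq> ?S\<close> seg by (auto simp: seg_def)
  finally show ?thesis .
qed

text \<open>For \<open>\<mu> \<ge> 1\<close> the integrand at \<open>\<mu> q\<close> is dominated by
  the one at \<open>q\<close>. The approach is radial because \<open>norm_divide_powr_ray\<close>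
  keeps such points inside the region of continuation.\<close>

lemma tendsto_laplace_ray:
  assumes "laplace_exists f q" and "Re q > 0"
  shows "(\<lambda>n. laplace f (of_real (1 + 1 / real (Suc n)) * q)) \<longlonglongrightarrow> laplace f q"
  unfolding laplace_eq
proof (rule integral_dominated_convergence)
  define \<mu> where "\<mu> n = 1 + 1 / real (Suc n)" for n
  have \<mu>: "\<mu> n \<ge> 1" for n
    by (simp add: \<mu>_def)
  have "\<mu> \<longlonglongrightarrow> 1 + 0"
    unfolding \<mu>_def[abs_def] by (intro tendsto_intros LIMSEQ_Suc[OF lim_1_over_n])
  then have lim: "(\<lambda>n. exp (- (of_real (\<mu> n) * q) * complex_of_real Y) * f Y)
      \<longlonglongrightarrow> exp (- (of_real 1 * q) * complex_of_real Y) * f Y" for Y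
    by (intro tendsto_intros) simp
  show "AE Y in lborel_pos. (\<lambda>n. exp (- (of_real (1 + 1 / real (Suc n)) * q) * complex_of_real Y) * f Y)
      \<longlonglongrightarrow> exp (- q * complex_of_real Y) * f Y"
    using lim by (intro AE_lborel_pos) (simp add: \<mu>_def)
  show "integrable lborel_pos (\<lambda>Y. norm (exp (- q * complex_of_real Y) * f Y))"
    using assms(1) unfolding laplace_exists_iff by (rule integrable_norm)
  fix n
  have "Re q \<le> \<mu> n * Re q"
    using mult_right_mono[OF \<mu>, of "Re q" n] assms(2) by simp
  then have "norm (exp (- (of_real (\<mu> n) * q) * complex_of_real Y) * f Y)
      \<le> norm (exp (- q * complex_of_real Y) * f Y)" if "Y > 0" for Y
    using that by (auto simp: norm_mult intro!: mult_right_mono)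
  then show "AE Y in lborel_pos. norm (exp (- (of_real (1 + 1 / real (Suc n)) * q) * complex_of_real Y) * f Y)
      \<le> norm (exp (- q * complex_of_real Y) * f Y)"
    by (intro AE_lborel_pos) (simp add: \<mu>_def)
qed (intro borel_measurable_exp_times_lborel_pos[OF assms(1)])+

text \<open>The second Prabhakar parameter is \<open>\<kappa>\<close>, not
  \<open>\<kappa> + 1\<close>, because the factor \<open>Gamma (\<kappa> + s)\<close> of the H--K
  series survives unchanged. The identity presupposes existence, as a divergent integral would count
  as 0; the other two conjuncts exhibit half-planes where existence holds.\<close>

theorem theorem13:
  fixes \<gamma>1 \<gamma>2 \<kappa> \<rho> \<upsilon> X w :: complex and f :: "real \<Rightarrow> complex"
  assumes "Re \<gamma>1 > 0" and "Re \<gamma>2 > 0" and "Re \<kappa> > 0" and "Re \<rho> > 0" and "Re \<upsilon> > 0"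
  defines "f \<equiv> \<lambda>Y. complex_of_real Y powr (\<rho> - 1) *
             HK_mittag_leffler \<kappa> \<rho> \<upsilon> \<gamma>1 \<gamma>2 ((\<gamma>1 + 1) / 2) \<gamma>2 X (w * complex_of_real Y)"
  shows "(\<forall>q. Re q > 0 \<and> norm (w powr \<upsilon> / q powr \<upsilon>) < 1 \<and> laplace_exists f q \<longrightarrow>
            laplace f q =
              1 / q powr \<rho> * ((q powr \<upsilon> - w powr \<upsilon>) / q powr \<upsilon>) powr (- \<gamma>2) *
              prabhakar 1 \<kappa> (\<gamma>1 / 2) (4 * q powr \<upsilon> * X / (q powr \<upsilon> - w powr \<upsilon>))) \<and>
         (\<exists>\<sigma>. \<forall>q. Re q > \<sigma> \<longrightarrow> laplace_exists f q) \<and>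
         (\<upsilon> \<in> \<real> \<longrightarrow> (\<forall>q. Re q > norm w \<longrightarrow> laplace_exists f q))"
proof -
  define W where "W = w powr \<upsilon>"
  define a where "a = Re \<upsilon>"
  have a: "a > 0"
    using assms by (simp add: a_def)
  obtain M K where MK: "M > 0" "K > 0"
      "\<And>r. Gamma (Re (\<rho> + \<upsilon> * of_nat r)) \<le> M * K ^ r * norm (Gamma (\<rho> + \<upsilon> * of_nat r))"
    and K1: "\<upsilon> \<in> \<real> \<Longrightarrow> K = 1"
    using Gamma_Re_le_affine[OF assms(4,5)] by metis
  note exists = laplace_exists_HK[OF assms(1-5) _ MK, where w = w and X = X, folded W_def a_def f_def]
  \<comment> \<open>The three entries secure, in turn, \<open>Re q > 0\<close>, convergence of the
    majorant, and \<open>norm (W / q powr \<upsilon>) < 1\<close> despite the factor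
    \<open>exp (\<bar>Im \<upsilon>\<bar> * pi)\<close>.\<close>
  define \<sigma> where "\<sigma> = max (max 1 ((K * norm W) powr (1 / a)))
      ((norm W * exp (\<bar>Im \<upsilon>\<bar> * pi)) powr (1 / a))"
  have \<sigma>: "Re q > 0" "K * norm W < Re q powr a" "norm (W / q powr \<upsilon>) < 1" if "Re q > \<sigma>" for q
  proof -
    show pos: "Re q > 0"
      using that by (auto simp: \<sigma>_def)
    show "K * norm W < Re q powr a"
      using that a MK by (intro less_powr_if_root_less) (auto simp: \<sigma>_def)
    have "norm W * exp (\<bar>Im \<upsilon>\<bar> * pi) < Re q powr a"
      using that a by (intro less_powr_if_root_less) (auto simp: \<sigma>_def)
    then have "norm W < Re q powr a * exp (- (\<bar>Im \<upsilon>\<bar> * pi))"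
      by (simp add: exp_minus field_simps)
    also have "\<dots> \<le> norm (q powr \<upsilon>)"
      using norm_powr_ge_Re[OF pos assms(5)] by (simp add: a_def)
    finally show "norm (W / q powr \<upsilon>) < 1"
      by (simp add: norm_divide divide_less_eq)
  qed
  define R where "R q = 1 / q powr \<rho> * (1 - W / q powr \<upsilon>) powr (- \<gamma>2) *
      prabhakar 1 \<kappa> (\<gamma>1 / 2) (4 * X / (1 - W / q powr \<upsilon>))" for q
  define D where "D c = {q. Re q > c \<and> norm (W / q powr \<upsilon>) < 1}" for c
  have far: "laplace f q = R q" if "Re q > \<sigma>" for q
    using laplace_HK[OF assms(1-5) \<sigma>(1)[OF that] MK, where w = w and X = X, folded W_def a_def f_def]
      \<sigma>(2,3)[OF that] by (simp add: R_def)
  have open_D: "open (D c)" if "c \<ge> 0" for c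
  proof -
    have "continuous_on {q. Re q > c} (\<lambda>q. norm (W / q powr \<upsilon>))"
      using that by (intro continuous_intros) (auto simp: complex_nonpos_Reals_iff)
    then have "open ({q. Re q > c} \<inter> (\<lambda>q. norm (W / q powr \<upsilon>)) -` {..<1})"
      by (rule continuous_open_preimage) (auto simp: open_halfspace_Re_gt)
    also have "{q. Re q > c} \<inter> (\<lambda>q. norm (W / q powr \<upsilon>)) -` {..<1} = D c"
      by (auto simp: D_def)
    finally show ?thesis .
  qed
  have hol_R: "R holomorphic_on D 0"
  proof -
    \<comment> \<open>The quotient has modulus below 1, so \<open>1 - W / q powr \<upsilon>\<close>
      has positive real part and avoids the branch cut.\<close>
    have 1: "1 - W / q powr \<upsilon> \<notin> \<real>\<^sub>\<le>\<^sub>0" "q \<notin> \<real>\<^sub>\<le>\<^sub>0" if "q \<in> D 0" for q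
      using that complex_Re_le_cmod[of "W / q powr \<upsilon>"]
      by (auto simp: D_def complex_nonpos_Reals_iff)
    have 2: "(\<lambda>q. 1 - W / q powr \<upsilon>) holomorphic_on D 0"
      using 1 by (intro holomorphic_intros) (auto simp: D_def)
    have 3: "(\<lambda>q. 4 * X / (1 - W / q powr \<upsilon>)) holomorphic_on D 0"
      using 1 by (intro holomorphic_intros 2) force
    have "prabhakar 1 \<kappa> (\<gamma>1 / 2) \<circ> (\<lambda>q. 4 * X / (1 - W / q powr \<upsilon>)) holomorphic_on D 0"
      by (rule holomorphic_on_compose[OF 3 holomorphic_prabhakar[OF assms(3)]])
    then show ?thesis
      unfolding R_def[abs_def] o_def using 1
      by (intro holomorphic_on_mult holomorphic_on_divide holomorphic_on_powr 2)
        (auto intro!: holomorphic_intros simp: D_def)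
  qed
  have "laplace f q = R q" if q: "Re q > 0" "norm (W / q powr \<upsilon>) < 1" "laplace_exists f q" for q
  proof -
    define p where "p n = of_real (1 + 1 / real (Suc n)) * q" for n
    have D_sub: "D (Re q) \<subseteq> D 0"
      using q(1) by (auto simp: D_def)
    have pD: "p n \<in> D (Re q)" for n
    proof -
      have "1 * Re q < (1 + 1 / real (Suc n)) * Re q"
        using q(1) by (intro mult_strict_right_mono) auto
      then show ?thesis
        using q(2) norm_divide_powr_ray[OF assms(5), of "1 + 1 / real (Suc n)" W q]
        by (simp add: p_def D_def del: of_nat_Suc of_real_add of_real_divide)
    qed
    \<comment> \<open>Continuation from a far half-plane, where \<open>far\<close> gives equality,
      to the connected region \<open>D (Re q)\<close>.\<close>
    have eq: "laplace f v = R v" if "v \<in> D (Re q)" for v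
    proof (rule analytic_continuation_open[where f = "laplace f" and g = R
          and s = "{v. Re v > max \<sigma> (Re q)}" and s' = "D (Re q)"])
      show "open {v. Re v > max \<sigma> (Re q)}"
        by (rule open_halfspace_Re_gt)
      show "open (D (Re q))"
        using q by (intro open_D) simp
      have "of_real (max \<sigma> (Re q) + 1) \<in> {v. Re v > max \<sigma> (Re q)}"
        by (simp add: max_def)
      then show "{v. Re v > max \<sigma> (Re q)} \<noteq> {}"
        by blast
      show "connected (D (Re q))"
        unfolding D_def
        by (rule connected_powr_region[where c' = "max \<sigma> (Re q)"]) (use assms(5) q \<sigma>(3) in auto)
      show "{v. Re v > max \<sigma> (Re q)} \<subseteq> D (Re q)"
        using \<sigma>(3) by (auto simp: D_def)
      show "laplace f holomorphic_on D (Re q)"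
        using holomorphic_laplace[OF q(3)] by (rule holomorphic_on_subset) (auto simp: D_def)
      show "R holomorphic_on D (Re q)"
        using hol_R D_sub by (rule holomorphic_on_subset)
    qed (use far that in auto)
    \<comment> \<open>\<open>q\<close> lies on the boundary of \<open>D (Re q)\<close> but inside
      \<open>D 0\<close>, where \<open>R\<close> is still continuous; thus \<open>R (p n)\<close>
      tends to \<open>R q\<close>.\<close>
    have qD: "q \<in> D 0"
      using q by (simp add: D_def)
    have "p \<longlonglongrightarrow> of_real (1 + 0) * q"
      unfolding p_def[abs_def] by (intro tendsto_intros LIMSEQ_Suc[OF lim_1_over_n])
    moreover have "\<forall>\<^sub>F n in sequentially. p n \<in> D 0"
      using pD D_sub by (intro always_eventually) blast
    ultimately have "(\<lambda>n. R (p n)) \<longlonglongrightarrow> R q"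
      using qD by (intro continuous_on_tendsto_compose[OF holomorphic_on_imp_continuous_on[OF hol_R]]) auto
    moreover have "(\<lambda>n. R (p n)) \<longlonglongrightarrow> laplace f q"
      using tendsto_laplace_ray[OF q(3,1)] eq[OF pD] by (simp add: p_def)
    ultimately show ?thesis
      by (rule LIMSEQ_unique[symmetric])
  qed
  moreover have "R q = 1 / q powr \<rho> * ((q powr \<upsilon> - W) / q powr \<upsilon>) powr (- \<gamma>2) *
              prabhakar 1 \<kappa> (\<gamma>1 / 2) (4 * q powr \<upsilon> * X / (q powr \<upsilon> - W))" if "Re q > 0" for q
  proof -
    have nz: "q powr \<upsilon> \<noteq> 0"
      using that by auto
    then have 1: "1 - W / q powr \<upsilon> = (q powr \<upsilon> - W) / q powr \<upsilon>"
      by (simp add: diff_divide_distrib)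
    show ?thesis
      unfolding R_def 1 by (simp add: mult_ac)
  qed
  moreover have "\<forall>q. Re q > \<sigma> \<longrightarrow> laplace_exists f q"
    using exists \<sigma> by blast
  moreover have "laplace_exists f q" if "\<upsilon> \<in> \<real>" "Re q > norm w" for q
  proof (rule exists)
    show "Re q > 0"
      using that norm_ge_zero[of w] by linarith
    \<comment> \<open>For real \<open>\<upsilon>\<close>, \<open>K = 1\<close> and
      \<open>norm W\<close> equals \<open>norm w powr a\<close>, so the majorant condition is
      exactly this inequality.\<close>
    have "norm w powr a < Re q powr a"
      using that a by (intro powr_less_mono2) auto
    then show "K * norm W < Re q powr a"
      using that K1 by (simp add: W_def a_def norm_powr_real_powr')
  qed
  ultimately show ?thesis
    unfolding W_def[symmetric] by (intro conjI) (auto simp: W_def)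
qed

end
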